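(* Let $p$ be the following version of the NSL protocol: $$\langle 1, A\to B:\{N_a.A\}_{k_b}\rangle.\ \langle 2, B\to A:\{B.N_a\}_{k_a}.\{B.N_b\}_{k_a}\rangle.\ \langle 3, A\to B: A.B.\{N_b\}_{k_b}\rangle,$$ analysed in the context of verification $\mathcal{C}$ with security lattice $(\mathcal{L},\sqsupseteq,\sqcup,\sqcap,\bot,\top)=(2^{\mathcal{I}},\subseteq,\cap,\cup,\mathcal{I},\emptyset)$ and levels $\ulcorner A\urcorner=\ulcorner B\urcorner=\bot$, $\ulcorner N_a^i\urcorner=\ulcorner N_b^i\urcorner=\{A,B\}$, $\ulcorner k_a^{-1}\urcorner=\{A\}$, $\ulcorner k_b^{-1}\urcorner=\{B\}$. Then $p$ is correct with respect to the secrecy property: there are no valid trace $\rho\in[\![p]\!]$ and atom $\alpha$ such that $\rho\models_{\mathcal{C}}\alpha$ and $\ulcorner K(I)\urcorner\not\sqsupseteq\ulcorner\alpha\urcorner$.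
   Context: $\mathcal{I}=\{I,A,B,A_1,A_2,B_1,B_2,\dots\}$ is the set of principal identities, $I$ being the intruder. Messages are terms built from atoms (principal identities, nonces, keys) by pairing $m_1.m_2$ and encryption $\{m\}_k$; $k_a$ is the public key of agent $A$ and $k_a^{-1}$ her private key. The security levels are elements of $2^{\mathcal{I}}$: $a\sqsupseteq b$ means $a\subseteq b$, $\bot=\mathcal{I}$ (public), $\top=\emptyset$. The level of an atom is the set of principals authorized to know it: principal identities (and public keys) have level $\bot$, the private key $k_a^{-1}$ of agent $A$ has level $\{A\}$, and nonces $N_a^i$, $N_b^i$ generated in session $i$ of a role of an agent $A$ (resp. $B$) for a run between $A$ and $B$ have level $\{A,B\}$. For a set $M$, $\ulcorner M\urcorner\sqsupseteq\ulcorner\alpha\urcorner$ means that some $m'\in M$ satisfies $\ulcorner m'\urcorner\sqsupseteq\ulcorner\alpha\urcorner$. $K(I)$ is the intruder's initial knowledge (all public keys and principal identities, her own private key, her own nonces). Intruder deduction $M\models_{\mathcal{C}}m$: from $M$ the intruder infers any $m\in M\cup K(I)$; from $m_1$ and $m_2$ she infers $m_1.m_2$, and from $m_1.m_2$ she infers $m_1$ and $m_2$; from $m$ and a key $k$ she infers $\{m\}_k$; from $\{m\}_k$ and the decryption key $k^{-1}$ she infers $m$. $\rho\models_{\mathcal{C}}m$ means that $m$ can be inferred from the messages exchanged in trace $\rho$. The generalized roles of $p$ (with $i$ a session identifier, fresh nonces indexed by $i$, $X,Y$ variables for messages the agent cannot verify, and $I(B)$ the intruder acting in the place of $B$) are: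 - Agent $A$: (i.1) $A\to I(B):\{N_a^i.A\}_{k_b}$; and its extension (i.1) $A\to I(B):\{N_a^i.A\}_{k_b}$, (i.2) $I(B)\to A:\{B.N_a^i\}_{k_a}.\{B.X\}_{k_a}$, (i.3) $A\to I(B):A.B.\{X\}_{k_b}$. - Agent $B$: (i.1) $I(A)\to B:\{Y.A\}_{k_b}$, (i.2) $B\to I(A):\{B.Y\}_{k_a}.\{B.N_b^i\}_{k_a}$; and its extension by (i.3) $I(A)\to B:A.B.\{N_b^i\}_{k_b}$. A valid trace is an interleaving of (arbitrarily many sessions of) substituted generalized roles, played by any principals, in which each message sent by the intruder can be inferred by her from the messages she has received so far and $K(I)$; the variables may be substituted by arbitrary messages. $[\![p]\!]$ is the set of valid traces. *)

theory Defs
  imports Main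
begin

datatype principal = Intruder | Agent nat

datatype key = Pub principal | Priv principal

fun inv_key :: "key \<Rightarrow> key" where
  "inv_key (Pub a) = Priv a"
| "inv_key (Priv a) = Pub a"

text \<open>\<open>Nonce i a b\<close> is the fresh nonce generated by \<open>a\<close> in session \<open>i\<close> of one of its roles, for
  a run between \<open>a\<close> and \<open>b\<close>.  So \<open>N\<^sub>a\<^sup>i\<close> is \<open>Nonce i A B\<close> and \<open>N\<^sub>b\<^sup>i\<close> is \<open>Nonce i B A\<close>.\<close>

datatype atom = Id principal | Nonce nat principal principal | Key key

datatype msg = Atom atom | Pair msg msg (infixr "\<cdot>" 65) | Enc msg key

abbreviation MId :: "principal \<Rightarrow> msg" where
  "MId a \<equiv> Atom (Id a)"

abbreviation MNonce :: "nat \<Rightarrow> principal \<Rightarrow> principal \<Rightarrow> msg" where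
  "MNonce i a b \<equiv> Atom (Nonce i a b)"


subsection \<open>Security levels\<close>

type_synonym seclevel = "principal set"

definition sec_ge :: "seclevel \<Rightarrow> seclevel \<Rightarrow> bool" (infix "\<sqsupseteq>" 50) where
  "a \<sqsupseteq> b \<longleftrightarrow> a \<subseteq> b"

definition sec_bot :: seclevel where
  "sec_bot = UNIV"

definition sec_top :: seclevel where
  "sec_top = {}"

lemma security_lattice:
  "class.bounded_lattice (\<union>) (\<lambda>a b. b \<sqsupseteq> a) (\<lambda>a b. b \<sqsupseteq> a \<and> a \<noteq> b) (\<inter>) sec_bot sec_top"
  by unfold_locales (auto simp: sec_ge_def sec_bot_def sec_top_def)

fun level :: "atom \<Rightarrow> seclevel" where
  "level (Id a) = sec_bot"
| "level (Nonce i a b) = {a, b}"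
| "level (Key (Pub a)) = sec_bot"
| "level (Key (Priv a)) = {a}"

definition set_level_ge :: "atom set \<Rightarrow> atom \<Rightarrow> bool" where
  "set_level_ge M \<alpha> \<longleftrightarrow> (\<exists>\<beta>\<in>M. level \<beta> \<sqsupseteq> level \<alpha>)"


subsection \<open>The intruder\<close>

definition K_I :: "atom set" where
  "K_I = range Id \<union> range (\<lambda>a. Key (Pub a)) \<union> {Key (Priv Intruder)}
         \<union> {Nonce i Intruder b | i b. True}"

inductive infers :: "msg set \<Rightarrow> msg \<Rightarrow> bool" for M :: "msg set" where
  known: "m \<in> M \<union> Atom ` K_I \<Longrightarrow> infers M m"
| pair: "infers M m1 \<Longrightarrow> infers M m2 \<Longrightarrow> infers M (m1 \<cdot> m2)"
| left: "infers M (m1 \<cdot> m2) \<Longrightarrow> infers M m1"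
| right: "infers M (m1 \<cdot> m2) \<Longrightarrow> infers M m2"
| encrypt: "infers M m \<Longrightarrow> infers M (Atom (Key k)) \<Longrightarrow> infers M (Enc m k)"
| decrypt: "infers M (Enc m k) \<Longrightarrow> infers M (Atom (Key (inv_key k))) \<Longrightarrow> infers M m"


subsection \<open>Traces\<close>

text \<open>\<open>Send i j a b m\<close> is the step \<open>(i.j) a \<rightarrow> I(b) : m\<close>, a message received by the intruder;
  \<open>Recv i j b a m\<close> is the step \<open>(i.j) I(b) \<rightarrow> a : m\<close>, a message sent by the intruder.\<close>

datatype event =
    is_Send: Send (session: nat) (step: nat) (sender: principal) (receiver: principal) (content: msg)
  | is_Recv: Recv (session: nat) (step: nat) (sender: principal) (receiver: principal) (content: msg)

type_synonym trace = "event list"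

text \<open>A protocol is given by the set of substituted instances of its generalized roles, for each
  session identifier.  Every instance taking part in a trace has its own session identifier, so
  an interleaving is a list whose restriction to each occurring identifier is such an instance.\<close>

definition interleaving :: "(nat \<Rightarrow> trace set) \<Rightarrow> trace \<Rightarrow> bool" where
  "interleaving roles \<rho> \<longleftrightarrow>
     (\<forall>i \<in> session ` set \<rho>. filter (\<lambda>e. session e = i) \<rho> \<in> roles i)"

definition received :: "trace \<Rightarrow> msg set" where
  "received \<rho> = {content e | e. e \<in> set \<rho> \<and> is_Send e}"

definition intruder_feasible :: "trace \<Rightarrow> bool" where
  "intruder_feasible \<rho> \<longleftrightarrow>
     (\<forall>n < length \<rho>. is_Recv (\<rho> ! n) \<longrightarrow> infers (received (take n \<rho>)) (content (\<rho> ! n)))"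

definition valid_traces :: "(nat \<Rightarrow> trace set) \<Rightarrow> trace set" where
  "valid_traces roles = {\<rho>. interleaving roles \<rho> \<and> intruder_feasible \<rho>}"

definition trace_infers :: "trace \<Rightarrow> msg \<Rightarrow> bool" where
  "trace_infers \<rho> m \<longleftrightarrow> infers (content ` set \<rho>) m"


subsection \<open>The protocol\<close>

text \<open>Generalized roles of
  \<open>\<langle>1, A \<rightarrow> B : {N\<^sub>a.A}k\<^sub>b\<rangle>. \<langle>2, B \<rightarrow> A : {B.N\<^sub>a}k\<^sub>a.{B.N\<^sub>b}k\<^sub>a\<rangle>. \<langle>3, A \<rightarrow> B : A.B.{N\<^sub>b}k\<^sub>b\<rangle>\<close>,
  where \<open>X\<close> and \<open>Y\<close> stand for what the agent cannot verify.  Each agent has two roles, one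
  ending with each of its outputs for \<open>A\<close>, and one with and one without step 3 for \<open>B\<close>.\<close>

definition role_A1 :: "nat \<Rightarrow> principal \<Rightarrow> principal \<Rightarrow> trace" where
  "role_A1 i A B = [Send i 1 A B (Enc (MNonce i A B \<cdot> MId A) (Pub B))]"

definition role_A2 :: "nat \<Rightarrow> principal \<Rightarrow> principal \<Rightarrow> msg \<Rightarrow> trace" where
  "role_A2 i A B X =
    [Send i 1 A B (Enc (MNonce i A B \<cdot> MId A) (Pub B)),
     Recv i 2 B A (Enc (MId B \<cdot> MNonce i A B) (Pub A) \<cdot> Enc (MId B \<cdot> X) (Pub A)),
     Send i 3 A B (MId A \<cdot> MId B \<cdot> Enc X (Pub B))]"

definition role_B1 :: "nat \<Rightarrow> principal \<Rightarrow> principal \<Rightarrow> msg \<Rightarrow> trace" where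
  "role_B1 i A B Y =
    [Recv i 1 A B (Enc (Y \<cdot> MId A) (Pub B)),
     Send i 2 B A (Enc (MId B \<cdot> Y) (Pub A) \<cdot> Enc (MId B \<cdot> MNonce i B A) (Pub A))]"

definition role_B2 :: "nat \<Rightarrow> principal \<Rightarrow> principal \<Rightarrow> msg \<Rightarrow> trace" where
  "role_B2 i A B Y =
    [Recv i 1 A B (Enc (Y \<cdot> MId A) (Pub B)),
     Send i 2 B A (Enc (MId B \<cdot> Y) (Pub A) \<cdot> Enc (MId B \<cdot> MNonce i B A) (Pub A)),
     Recv i 3 A B (MId A \<cdot> MId B \<cdot> Enc (MNonce i B A) (Pub B))]"

definition nsl_roles :: "nat \<Rightarrow> trace set" where
  "nsl_roles i =
     {role_A1 i A B | A B. True} \<union> {role_A2 i A B X | A B X. True}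
     \<union> {role_B1 i A B Y | A B Y. True} \<union> {role_B2 i A B Y | A B Y. True}"

end

(* Call an atom public if the intruder belongs to its level. A secret nonce shared by A and B only
   ever occurs in a trace in the shapes {N}, {N.A} or {A.N} under the public key of B (or with A and
   B exchanged). A nonce is not an identity, so the recipient of such a ciphertext can only parse it
   in one way, which forces the peer it answers to be the other owner of the nonce. Hence honest
   replies stay within these shapes, and intruder deduction never opens them. *)
theory Submission imports Defs begin

text \<open>With \<open>B \<noteq> Intruder\<close> the decryption key \<open>Priv B\<close> is
  secret. \<open>A\<close> may be the intruder: the nonce is then public anyway.\<close>

definition guarded :: "msg \<Rightarrow> key \<Rightarrow> bool" where
  "guarded m k \<longleftrightarrow> (\<exists>A B i. B \<noteq> Intruder \<and> k = Pub B \<and>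
     (\<exists>N \<in> {MNonce i A B, MNonce i B A}. m \<in> {N, N \<cdot> MId A, MId A \<cdot> N}))"

fun safe :: "msg \<Rightarrow> bool" where
  "safe (Atom a) \<longleftrightarrow> Intruder \<in> level a"
| "safe (m \<cdot> n) \<longleftrightarrow> safe m \<and> safe n"
| "safe (Enc m k) \<longleftrightarrow> safe m \<or> guarded m k"

lemma Intruder_in_sec_bot [simp]: "Intruder \<in> sec_bot"
  by (simp add: sec_bot_def)

lemma safe_K_I: "a \<in> K_I \<Longrightarrow> safe (Atom a)"
  by (auto simp: K_I_def)

text \<open>Only decryption is critical: a guarded ciphertext opens with some \<open>Priv B\<close>,
  \<open>B \<noteq> Intruder\<close>, which is not safe, so the content was safe already.\<close>

lemma infers_safe:
  assumes "infers M m" and "\<forall>m \<in> M. safe m"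
  shows "safe m"
  using assms(1)
proof induction
  case (known m)
  then show ?case using assms(2) safe_K_I by blast
next
  case (decrypt m k)
  then show ?case by (auto simp: guarded_def)
qed simp_all

text \<open>If \<open>B\<close> is the intruder, she owns the nonce and it is public; otherwise the
  ciphertext is guarded.\<close>

lemma safe_request: "safe (Enc (MNonce i A B \<cdot> MId A) (Pub B))"
  by (auto simp: guarded_def)

lemma safe_challenge: "safe (Enc (MId B \<cdot> MNonce i B A) (Pub A))"
  by (auto simp: guarded_def)

text \<open>In the guarded case the final identity forces \<open>Y\<close> to be a nonce of
  \<open>A\<close> and \<open>B\<close>. The echo is guarded again, or \<open>Y\<close> is public
  when \<open>A\<close> is the intruder.\<close>

lemma safe_echo:
  assumes "safe (Enc (Y \<cdot> MId A) (Pub B))"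
  shows "safe (Enc (MId B \<cdot> Y) (Pub A))"
  using assms by (auto simp: guarded_def)

text \<open>Here the leading identity \<open>B\<close> forces a guarded \<open>X\<close> to be a
  nonce shared with \<open>B\<close>; without that name the peer would be undetermined.\<close>

lemma safe_response:
  assumes "safe (Enc (MId B \<cdot> X) (Pub A))"
  shows "safe (Enc X (Pub B))"
  using assms by (auto simp: guarded_def)

lemma role_send_safe:
  assumes "xs @ e # ys \<in> nsl_roles i" and "is_Send e" and "\<forall>e' \<in> set xs. safe (content e')"
  shows "safe (content e)"
proof -
  consider (A1) A B where "xs @ e # ys = role_A1 i A B"
    | (A2) A B X where "xs @ e # ys = role_A2 i A B X"
    | (B1) A B Y where "xs @ e # ys = role_B1 i A B Y"
    | (B2) A B Y where "xs @ e # ys = role_B2 i A B Y"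
    using assms(1) unfolding nsl_roles_def by blast
  then show ?thesis
  proof cases
    case A1
    then show ?thesis
      using safe_request by (auto simp: role_A1_def append_eq_Cons_conv simp del: safe.simps(3))
  next
    case A2
    then show ?thesis
      using assms(2,3) safe_request safe_response[of B X A]
      by (auto simp: role_A2_def append_eq_Cons_conv simp del: safe.simps(3))
  next
    case B1
    then show ?thesis
      using assms(2,3) safe_challenge safe_echo[of Y A B]
      by (auto simp: role_B1_def append_eq_Cons_conv simp del: safe.simps(3))
  next
    case B2
    then show ?thesis
      using assms(2,3) safe_challenge safe_echo[of Y A B]
      by (auto simp: role_B2_def append_eq_Cons_conv simp del: safe.simps(3))
  qed
qed

lemma valid_trace_safe:
  assumes "\<rho> \<in> valid_traces nsl_roles" and "n < length \<rho>"
  shows "safe (content (\<rho> ! n))"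
  using assms(2)
proof (induction n rule: less_induct)
  case (less n)
  let ?e = "\<rho> ! n" and ?f = "filter (\<lambda>e. session e = session (\<rho> ! n))"
  have prefix_safe: "\<forall>e \<in> set (take n \<rho>). safe (content e)"
    using less by (auto simp: in_set_conv_nth)
  show ?case
  proof (cases ?e)
    case Recv
    then have "infers (received (take n \<rho>)) (content ?e)"
      using assms(1) less.prems by (auto simp: valid_traces_def intruder_feasible_def
          dest!: spec[of _ n])
    then show ?thesis
      by (rule infers_safe) (use prefix_safe in \<open>auto simp: received_def\<close>)
  next
    case Send
    have "?f \<rho> \<in> nsl_roles (session ?e)"
      using assms(1) less.prems by (simp add: valid_traces_def interleaving_def)
    \<comment> \<open>The earlier events of the same session all lie in the prefix, so the induction
      hypothesis covers whatever the reply depends on.\<close>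
    moreover have "?f \<rho> = ?f (take n \<rho>) @ ?e # ?f (drop (Suc n) \<rho>)"
      by (subst id_take_nth_drop[OF less.prems]) simp
    ultimately have "?f (take n \<rho>) @ ?e # ?f (drop (Suc n) \<rho>) \<in> nsl_roles (session ?e)"
      by simp
    then show ?thesis
      by (rule role_send_safe) (use Send prefix_safe in auto)
  qed
qed

theorem mainTheorem5:
  "\<not> (\<exists>\<rho> \<in> valid_traces nsl_roles. \<exists>\<alpha> :: atom.
        trace_infers \<rho> (Atom \<alpha>) \<and> \<not> set_level_ge K_I \<alpha>)"
proof (intro notI, elim bexE exE conjE)
  fix \<rho> \<alpha>
  assume valid: "\<rho> \<in> valid_traces nsl_roles" and inf: "trace_infers \<rho> (Atom \<alpha>)"
    and secret: "\<not> set_level_ge K_I \<alpha>"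
  have "\<forall>m \<in> content ` set \<rho>. safe m"
    using valid_trace_safe[OF valid] by (auto simp: in_set_conv_nth)
  then have "safe (Atom \<alpha>)"
    using inf infers_safe by (simp only: trace_infers_def)
  \<comment> \<open>Her private key has level exactly \<open>{Intruder}\<close>, so it dominates
    every public atom.\<close>
  then have "level (Key (Priv Intruder)) \<sqsupseteq> level \<alpha>"
    by (simp add: sec_ge_def)
  then have "set_level_ge K_I \<alpha>"
    unfolding set_level_ge_def by (rule bexI) (simp add: K_I_def)
  with secret show False ..
qed

end
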